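(* Let $\mathcal{F}\subset\mathbb{Z}^d$ be finite and let $\mathcal{M}=\{m_1,\dots,m_k\}\subset\mathbb{Z}^d$ be an augmenting Markov basis for $\mathcal{F}$. Let $\pi$ be the uniform distribution on $\mathcal{F}$ and let $f$ be a positive mass function on $\mathcal{M}$. For $i\in[k]$ let $r_i:=\max\{|\mathcal{R}_{\mathcal{F}}(u,m_i)|: u\in\mathcal{F}\}$, and suppose $r_1\ge r_2\ge\dots\ge r_k$. Writing $L:=\operatorname{aug}_{\mathcal{F}}(\mathcal{M})$, we have \[ \lambda(\mathcal{H}^{\pi}_{f}(\mathcal{F},\mathcal{M}))\le 1-\frac{|\mathcal{F}|\cdot\min(f)}{L\cdot L!\cdot 3^{L-1}\cdot 2^{|\mathcal{M}|}\cdot r_1r_2\cdots r_{L}}. \]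
   Context: For finite $\mathcal{F}\subset\mathbb{Z}^d$, $u\in\mathcal{F}$ and $m\in\mathbb{Z}^d$, the ray through $u$ along $m$ is $\mathcal{R}_{\mathcal{F}}(u,m):=(u+\mathbb{Z}m)\cap\mathcal{F}$. A mass function on a finite set $\Omega$ is $g:\Omega\to[0,1]$ with $\sum_\omega g(\omega)=1$; it is positive if $g(\omega)>0$ for all $\omega$; $\min(f):=\min_{m\in\mathcal{M}}f(m)$; for $S\subseteq\mathcal{F}$, $\pi(S)=\sum_{y\in S}\pi(y)$. For a mass function $\pi$ on $\mathcal{F}$ and $m\in\mathbb{Z}^d$, $\mathcal{H}^{\pi}_{\mathcal{F},m}$ is the $\mathcal{F}\times\mathcal{F}$ matrix with entries $\pi(y)/\pi(\mathcal{R}_{\mathcal{F}}(x,m))$ if $y\in\mathcal{R}_{\mathcal{F}}(x,m)$ and $0$ otherwise. The heat-bath random walk is $\mathcal{H}^{\pi}_f(\mathcal{F},\mathcal{M}):=\sum_{m\in\mathcal{M}}f(m)\mathcal{H}^{\pi}_{\mathcal{F},m}$. Standing assumption: for all $m\in\mathcal{M}$ and $\lambda\in\mathbb{Z}\setminus\{-1,1\}$, $\lambda m\notin\mathcal{M}$. For a matrix $H$ of size $n$ with real eigenvalues $1=\lambda_1\ge\lambda_2\ge\dots\ge\lambda_n$, $\lambda(H):=\max\{\lambda_2,-\lambda_n\}$. The graph $\mathcal{F}(\mathcal{M})$ has nodes $\mathcal{F}$ with $u,v$ adjacent iff $u-v\in\pm\mathcal{M}$; its compression is $\mathcal{F}^c(\mathcal{M}):=\mathcal{F}(\mathbb{Z}\cdot\mathcal{M})$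 with $\mathbb{Z}\cdot\mathcal{M}=\{\lambda m:\lambda\in\mathbb{Z},m\in\mathcal{M}\}$. $\mathcal{M}$ is a Markov basis for $\mathcal{F}$ if $\mathcal{F}(\mathcal{M})$ is connected. An augmenting path between distinct $u,v\in\mathcal{F}$ of length $r$ is a path in $\mathcal{F}^c(\mathcal{M})$ of the form $u\to u+\lambda_{i_1}m_{i_1}\to u+\lambda_{i_1}m_{i_1}+\lambda_{i_2}m_{i_2}\to\dots\to u+\sum_{j=1}^r\lambda_{i_j}m_{i_j}=v$ with $\lambda_{i_j}\in\mathbb{Z}$ and pairwise distinct indices $i_1,\dots,i_r\in[k]$; it is minimal if no shorter augmenting path between $u$ and $v$ exists. A Markov basis $\mathcal{M}$ for $\mathcal{F}$ is augmenting if there is an augmenting path between any two distinct nodes of $\mathcal{F}$, and its augmentation length $\operatorname{aug}_{\mathcal{F}}(\mathcal{M})$ is the maximum length of all minimal augmenting paths in $\mathcal{F}^c(\mathcal{M})$. *)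

theory Defs
  imports
    "HOL-Analysis.Finite_Cartesian_Product"
    "HOL-Library.Countable_Set"
    "Jordan_Normal_Form.Char_Poly"
begin

definition mass_function :: "'a set \<Rightarrow> ('a \<Rightarrow> real) \<Rightarrow> bool" where
  "mass_function \<Omega> g \<longleftrightarrow> (\<forall>\<omega>\<in>\<Omega>. 0 \<le> g \<omega> \<and> g \<omega> \<le> 1) \<and> (\<Sum>\<omega>\<in>\<Omega>. g \<omega>) = 1"

definition positive_mass_function :: "'a set \<Rightarrow> ('a \<Rightarrow> real) \<Rightarrow> bool" where
  "positive_mass_function \<Omega> g \<longleftrightarrow> mass_function \<Omega> g \<and> (\<forall>\<omega>\<in>\<Omega>. g \<omega> > 0)"

definition uniform_mass :: "'a set \<Rightarrow> 'a \<Rightarrow> real" where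
  "uniform_mass \<Omega> \<omega> = 1 / real (card \<Omega>)"

definition ray :: "(int ^ 'd) set \<Rightarrow> int ^ 'd \<Rightarrow> int ^ 'd \<Rightarrow> (int ^ 'd) set" where
  "ray F u m = {u + l *s m | l. True} \<inter> F"

text \<open>Matrices with rows and columns indexed by a finite set are represented as functions
  of two arguments; only the values on that set are relevant.\<close>

definition heat_bath_move ::
    "(int ^ 'd) set \<Rightarrow> (int ^ 'd \<Rightarrow> real) \<Rightarrow> int ^ 'd \<Rightarrow> int ^ 'd \<Rightarrow> int ^ 'd \<Rightarrow> real" where
  "heat_bath_move F \<pi> m x y = (if y \<in> ray F x m then \<pi> y / (\<Sum>z\<in>ray F x m. \<pi> z) else 0)"

definition heat_bath ::
    "(int ^ 'd) set \<Rightarrow> (int ^ 'd) set \<Rightarrow> (int ^ 'd \<Rightarrow> real) \<Rightarrow> (int ^ 'd \<Rightarrow> real)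
      \<Rightarrow> int ^ 'd \<Rightarrow> int ^ 'd \<Rightarrow> real" where
  "heat_bath F M \<pi> f x y = (\<Sum>m\<in>M. f m * heat_bath_move F \<pi> m x y)"

text \<open>For finite \<open>\<Omega>\<close>, \<^term>\<open>from_nat_into \<Omega>\<close> restricts to a bijection from \<open>{..<card \<Omega>}\<close> to \<open>\<Omega>\<close>.
  The characteristic polynomial does not depend on which bijection is used.\<close>

definition matrix_on :: "'a set \<Rightarrow> ('a \<Rightarrow> 'a \<Rightarrow> real) \<Rightarrow> real mat" where
  "matrix_on \<Omega> A =
    mat (card \<Omega>) (card \<Omega>) (\<lambda>(i, j). A (from_nat_into \<Omega> i) (from_nat_into \<Omega> j))"

text \<open>The eigenvalues, repeated according to algebraic multiplicity, in descending order.
  The list exists (and is then unique) if and only if all eigenvalues are real.\<close>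

definition eigenvalues_desc :: "real mat \<Rightarrow> real list" where
  "eigenvalues_desc A =
    (THE ls. sorted_wrt (\<ge>) ls \<and> char_poly A = (\<Prod>a\<leftarrow>ls. [:- a, 1:]))"

text \<open>\<open>max {\<lambda>\<^sub>2, -\<lambda>\<^sub>n}\<close>, meaningful for size \<open>n \<ge> 2\<close>. List positions count from 0.\<close>

definition second_eigenvalue_modulus :: "real mat \<Rightarrow> real" where
  "second_eigenvalue_modulus A =
    (let ls = eigenvalues_desc A in max (ls ! 1) (- last ls))"

definition fiber_graph :: "(int ^ 'd) set \<Rightarrow> (int ^ 'd) set \<Rightarrow> (int ^ 'd) rel" where
  "fiber_graph F M = {(u, v). u \<in> F \<and> v \<in> F \<and> u - v \<in> M \<union> uminus ` M}"

definition int_multiples :: "(int ^ 'd) set \<Rightarrow> (int ^ 'd) set" where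
  "int_multiples M = {l *s m | l m. m \<in> M}"

definition compression :: "(int ^ 'd) set \<Rightarrow> (int ^ 'd) set \<Rightarrow> (int ^ 'd) rel" where
  "compression F M = fiber_graph F (int_multiples M)"

definition markov_basis :: "(int ^ 'd) set \<Rightarrow> (int ^ 'd) set \<Rightarrow> bool" where
  "markov_basis F M \<longleftrightarrow> (\<forall>u\<in>F. \<forall>v\<in>F. (u, v) \<in> (fiber_graph F M)\<^sup>*)"

text \<open>A path is given by its list of steps \<open>(\<lambda>, m)\<close>, each adding \<open>\<lambda> m\<close>;
  \<open>path_node u ps j\<close> is the node reached from \<open>u\<close> after the first \<open>j\<close> steps.\<close>

definition path_node :: "int ^ 'd \<Rightarrow> (int \<times> (int ^ 'd)) list \<Rightarrow> nat \<Rightarrow> int ^ 'd" where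
  "path_node u ps j = u + (\<Sum>(l, m)\<leftarrow>take j ps. l *s m)"

text \<open>Distinct indices of moves are expressed as distinct moves. Repeated nodes (in particular
  zero coefficients) are not excluded: deleting the steps between two visits to a node leaves an
  augmenting path that is shorter, so neither the existence of augmenting paths nor the minimal
  ones are affected.\<close>

definition augmenting_path ::
    "(int ^ 'd) set \<Rightarrow> (int ^ 'd) set \<Rightarrow> int ^ 'd \<Rightarrow> int ^ 'd \<Rightarrow> (int \<times> (int ^ 'd)) list \<Rightarrow> bool" where
  "augmenting_path F M u v ps \<longleftrightarrow>
    u \<in> F \<and> v \<in> F \<and> u \<noteq> v \<and>
    snd ` set ps \<subseteq> M \<and> distinct (map snd ps) \<and>
    (\<forall>j<length ps. (path_node u ps j, path_node u ps (Suc j)) \<in> compression F M) \<and>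
    path_node u ps (length ps) = v"

definition minimal_augmenting_path ::
    "(int ^ 'd) set \<Rightarrow> (int ^ 'd) set \<Rightarrow> int ^ 'd \<Rightarrow> int ^ 'd \<Rightarrow> (int \<times> (int ^ 'd)) list \<Rightarrow> bool" where
  "minimal_augmenting_path F M u v ps \<longleftrightarrow>
    augmenting_path F M u v ps \<and>
    \<not> (\<exists>qs. augmenting_path F M u v qs \<and> length qs < length ps)"

definition augmenting_markov_basis :: "(int ^ 'd) set \<Rightarrow> (int ^ 'd) set \<Rightarrow> bool" where
  "augmenting_markov_basis F M \<longleftrightarrow>
    markov_basis F M \<and>
    (\<forall>u\<in>F. \<forall>v\<in>F. u \<noteq> v \<longrightarrow> (\<exists>ps. augmenting_path F M u v ps))"

definition augmentation_length :: "(int ^ 'd) set \<Rightarrow> (int ^ 'd) set \<Rightarrow> nat" where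
  "augmentation_length F M = Max {length ps | u v ps. minimal_augmenting_path F M u v ps}"

end

theory Submission
  imports Defs "Jordan_Normal_Form.Schur_Decomposition" "HOL-Combinatorics.Multiset_Permutations"
begin

text \<open>
  For uniform \<open>\<pi>\<close> every heat-bath move is the orthogonal projection onto the functions that are
  constant on the rays along it, so the walk is a symmetric positive semidefinite matrix \<open>H\<close> with
  row sums 1, and only \<open>\<lambda>\<^sub>2\<close> matters. A Poincare inequality
  \<open>\<Sum>\<^sub>x\<^sub>,\<^sub>y (\<phi> x - \<phi> y)\<^sup>2 \<le> K \<Sum>\<^sub>x\<^sub>,\<^sub>y H x y (\<phi> x - \<phi> y)\<^sup>2\<close> gives \<open>\<lambda>\<^sub>2 \<le> 1 - |F| / K\<close>. It is obtained without
  fixing canonical paths: any two nodes are joined by a walk along some list \<open>\<sigma>\<close> of at most \<open>L\<close>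
  distinct moves, there are at most \<open>2\<^bsup>|M|\<^esup> L!\<close> such lists, and for each fixed \<open>\<sigma>\<close> the differences over
  all pairs joined along \<open>\<sigma>\<close> are bounded by Cauchy-Schwarz, one step of \<open>\<sigma>\<close> at a time, where each
  move contributes at most its maximal ray length. The factor \<open>3\<^bsup>L - 1\<^esup>\<close> is only slack.
\<close>

section \<open>Eigenvalues of symmetric matrices\<close>

text \<open>For an eigenvector \<open>x\<close> the form \<open>Q\<close> is \<open>k\<close> times
  the squared norm \<open>S\<close> of \<open>x\<close>. Symmetry makes \<open>Q\<close> its own
  conjugate, and \<open>S\<close> is real and nonzero, so \<open>k\<close> is its own conjugate
  too.\<close>

lemma eigenvalue_real_if_symmetric:
  fixes A :: "real mat"
  assumes A: "A \<in> carrier_mat n n"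
    and sym: "\<And>i j. i < n \<Longrightarrow> j < n \<Longrightarrow> A $$ (i, j) = A $$ (j, i)"
    and ev: "eigenvalue (map_mat complex_of_real A) k"
  shows "Im k = 0"
proof -
  obtain v where v: "v \<in> carrier_vec n" "v \<noteq> 0\<^sub>v n"
    and Av: "map_mat complex_of_real A *\<^sub>v v = k \<cdot>\<^sub>v v"
    using ev A unfolding eigenvalue_def eigenvector_def by auto
  define x where "x i = vec_index v i" for i
  have eq: "(\<Sum>j<n. complex_of_real (A $$ (i, j)) * x j) = k * x i" if "i < n" for i
  proof -
    have "vec_index (map_mat complex_of_real A *\<^sub>v v) i = (\<Sum>j<n. complex_of_real (A $$ (i, j)) * x j)"
      using that A v by (auto simp: scalar_prod_def x_def lessThan_atLeast0 intro!: sum.cong)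
    moreover have "vec_index (k \<cdot>\<^sub>v v) i = k * x i"
      using that v by (simp add: x_def)
    ultimately show ?thesis using Av by simp
  qed
  define S where "S = (\<Sum>i<n. cnj (x i) * x i)"
  have S: "S = of_real (\<Sum>i<n. (cmod (x i))\<^sup>2)"
    unfolding S_def of_real_sum
    by (intro sum.cong refl) (metis complex_norm_square mult.commute of_real_power)
  define Q where "Q = (\<Sum>i<n. \<Sum>j<n. complex_of_real (A $$ (i, j)) * cnj (x i) * x j)"
  have Q: "Q = k * S"
  proof -
    have "Q = (\<Sum>i<n. cnj (x i) * (\<Sum>j<n. complex_of_real (A $$ (i, j)) * x j))"
      unfolding Q_def by (simp add: sum_distrib_left mult_ac)
    also have "\<dots> = (\<Sum>i<n. cnj (x i) * (k * x i))"
      by (rule sum.cong) (auto simp: eq)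
    finally show ?thesis by (simp add: S_def sum_distrib_left mult_ac)
  qed
  have "cnj Q = (\<Sum>i<n. \<Sum>j<n. complex_of_real (A $$ (i, j)) * x i * cnj (x j))"
    unfolding Q_def by simp
  also have "\<dots> = (\<Sum>j<n. \<Sum>i<n. complex_of_real (A $$ (i, j)) * x i * cnj (x j))"
    by (rule sum.swap)
  also have "\<dots> = Q" unfolding Q_def
    by (intro sum.cong) (auto simp: sym mult_ac)
  finally have "cnj k * S = k * S"
    using Q S by (metis complex_cnj_complex_of_real complex_cnj_mult)
  moreover have "S \<noteq> 0"
  proof -
    obtain i where i: "i < n" "x i \<noteq> 0"
      using v unfolding x_def by (metis carrier_vecD eq_vecI index_zero_vec)
    have "(cmod (x i))\<^sup>2 \<le> (\<Sum>i<n. (cmod (x i))\<^sup>2)"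
      by (rule member_le_sum) (use i in auto)
    moreover have "0 < (cmod (x i))\<^sup>2" using i by simp
    ultimately show ?thesis unfolding S of_real_eq_0_iff by linarith
  qed
  ultimately have "cnj k = k" by simp
  then show ?thesis by (simp add: complex_eq_iff)
qed

text \<open>The complex roots are real, so the complex factorisation is the image of a real one.
  This is the existence behind the \<open>THE\<close> in \<open>eigenvalues_desc\<close>.\<close>

lemma char_poly_splits_if_symmetric:
  fixes A :: "real mat"
  assumes A: "A \<in> carrier_mat n n"
    and sym: "\<And>i j. i < n \<Longrightarrow> j < n \<Longrightarrow> A $$ (i, j) = A $$ (j, i)"
  obtains ls where "sorted_wrt (\<ge>) ls" "char_poly A = (\<Prod>a\<leftarrow>ls. [:- a, 1:])"
proof -
  let ?C = "map_mat complex_of_real A"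
  have C: "?C \<in> carrier_mat n n" using A by simp
  obtain as where as: "char_poly ?C = (\<Prod>a\<leftarrow>as. [:- a, 1:])"
    using char_poly_factorized[OF C] by blast
  have real: "complex_of_real (Re a) = a" if "a \<in> set as" for a
  proof -
    have "poly (char_poly ?C) a = 0"
      unfolding as poly_prod_list using that by (auto simp: prod_list_zero_iff)
    then have "Im a = 0"
      using eigenvalue_real_if_symmetric[OF A sym] eigenvalue_root_char_poly[OF C] by blast
    then show ?thesis by (simp add: complex_eq_iff)
  qed
  let ?bs = "map Re as"
  interpret h: map_poly_inj_idom_hom complex_of_real ..
  have "map_poly complex_of_real (char_poly A) = (\<Prod>a\<leftarrow>as. [:- a, 1:])"
    by (rule trans[OF of_real_hom.char_poly_hom[OF A, symmetric] as])
  also have "\<dots> = (\<Prod>a\<leftarrow>as. [:- complex_of_real (Re a), 1:])"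
    by (rule arg_cong[where f = prod_list], rule map_cong) (auto simp: real)
  also have "\<dots> = map_poly complex_of_real (\<Prod>a\<leftarrow>?bs. [:- a, 1:])"
    by (simp add: h.hom_prod_list o_def)
  finally have *: "char_poly A = (\<Prod>a\<leftarrow>?bs. [:- a, 1:])"
    by simp
  let ?ls = "rev (sort ?bs)"
  have "(\<Prod>a\<leftarrow>?ls. [:- a, 1:]) = (\<Prod>a\<in>#mset ?ls. [:- a, 1:])"
    by (simp only: mset_map[symmetric] prod_mset_prod_list)
  also have "mset ?ls = mset ?bs" by simp
  also have "(\<Prod>a\<in>#mset ?bs. [:- a, 1:]) = (\<Prod>a\<leftarrow>?bs. [:- a, 1:])"
    by (simp only: mset_map[symmetric] prod_mset_prod_list)
  finally have "char_poly A = (\<Prod>a\<leftarrow>?ls. [:- a, 1:])" using * by simp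
  moreover have "sorted_wrt (\<ge>) ?ls"
    by (simp add: sorted_wrt_rev)
  ultimately show ?thesis using that by blast
qed

text \<open>The product determines the multiset of its roots, and a multiset has only one sorted
  list.\<close>

lemma eigenvalues_desc_eqI:
  assumes "sorted_wrt (\<ge>) ls" "char_poly A = (\<Prod>a\<leftarrow>ls. [:- a, 1:])"
  shows "eigenvalues_desc A = ls"
  unfolding eigenvalues_desc_def
proof (rule the_equality)
  fix xs assume xs: "sorted_wrt (\<ge>) xs \<and> char_poly A = (\<Prod>a\<leftarrow>xs. [:- a, 1:])"
  have roots: "proots (\<Prod>a\<leftarrow>ys. [:- a, 1:]) = mset ys" for ys :: "real list"
  proof (induction ys)
    case (Cons y ys)
    have "(\<Prod>a\<leftarrow>ys. [:- a, 1:]) \<noteq> 0" by (auto simp: prod_list_zero_iff)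
    then show ?case using Cons by (simp add: proots_mult del: mult_pCons_left)
  qed simp
  have "mset xs = mset ls" using roots[of xs] roots[of ls] xs assms by simp
  then have "mset (rev xs) = mset (rev ls)" by simp
  moreover have "sorted (rev xs)" "sorted (rev ls)"
    using xs assms by (simp_all add: sorted_wrt_rev)
  ultimately have "rev xs = rev ls" by (metis properties_for_sort)
  then show "xs = ls" by simp
qed (use assms in auto)

text \<open>In a Schur decomposition \<open>A = P * B * Q\<close> with \<open>c\<close> listed first
  twice, the first two columns of \<open>A * P = P * B\<close> are the two equations, and
  \<open>b\<close> is the entry of \<open>B\<close> above the diagonal. A nonzero \<open>b\<close>
  is a Jordan block; it is ruled out where the lemma is applied.\<close>

lemma repeated_root_generalized_eigenvectors:
  fixes A :: "real mat"
  assumes A: "A \<in> carrier_mat n n"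
    and cp: "char_poly A = (\<Prod>a\<leftarrow>c # c # as. [:- a, 1:])"
  obtains v w :: "nat \<Rightarrow> real" and b
  where "\<And>i. i < n \<Longrightarrow> (\<Sum>j<n. A $$ (i, j) * v j) = c * v i"
    and "\<And>i. i < n \<Longrightarrow> (\<Sum>j<n. A $$ (i, j) * w j) = b * v i + c * w i"
    and "\<And>s t. (\<And>i. i < n \<Longrightarrow> s * v i + t * w i = 0) \<Longrightarrow> s = 0 \<and> t = 0"
proof -
  obtain B P Q where "schur_decomposition A (c # c # as) = (B, P, Q)"
    by (cases "schur_decomposition A (c # c # as)") auto
  from schur_decomposition[OF A cp this]
  have sim: "similar_mat_wit A B P Q" and up: "upper_triangular B" and diag: "diag_mat B = c # c # as"
    by auto
  note s = similar_mat_witD2[OF A sim]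
  have B: "B \<in> carrier_mat n n" and P: "P \<in> carrier_mat n n" and Q: "Q \<in> carrier_mat n n"
    and QP: "Q * P = 1\<^sub>m n" and eq: "A = P * B * Q" using s by auto
  have n: "n \<ge> 2" using arg_cong[OF diag, of length] B by (simp add: diag_mat_def)
  have B00: "B $$ (0, 0) = c" and B11: "B $$ (1, 1) = c"
    using arg_cong[OF diag, of "\<lambda>xs. xs ! 0"] arg_cong[OF diag, of "\<lambda>xs. xs ! 1"] n B
    by (simp_all add: diag_mat_def)
  have Bz: "B $$ (i, j) = 0" if "j < i" "i < n" for i j
    using upper_triangularD[OF up] that B by auto
  have "A * P = P * B * (Q * P)" unfolding eq using B P Q by (simp add: assoc_mult_mat[of _ n n _ n _ n])
  then have AP: "A * P = P * B" using QP P B by simp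
  have ent: "(\<Sum>k<n. X $$ (i, k) * Y $$ (k, j)) = (X * Y) $$ (i, j)"
    if "X \<in> carrier_mat n n" "Y \<in> carrier_mat n n" "i < n" "j < n" for X Y :: "real mat" and i j
    using that by (auto simp: scalar_prod_def lessThan_atLeast0 intro!: sum.cong)
  have APe: "(\<Sum>k<n. A $$ (i, k) * P $$ (k, j)) = (\<Sum>k<n. P $$ (i, k) * B $$ (k, j))"
    if "i < n" "j < n" for i j
    using ent[OF A P that] ent[OF P B that] AP by simp
  have QPe: "(\<Sum>k<n. Q $$ (i, k) * P $$ (k, j)) = (if i = j then 1 else 0)"
    if "i < n" "j < n" for i j
    using ent[OF Q P that] QP that by simp
  show ?thesis
  proof (rule that[of "\<lambda>i. P $$ (i, 0)" "\<lambda>i. P $$ (i, 1)" "B $$ (0, 1)"])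
    fix i assume i: "i < n"
    have "(\<Sum>k<n. P $$ (i, k) * B $$ (k, 0)) = (\<Sum>k\<in>{0}. P $$ (i, k) * B $$ (k, 0))"
      by (rule sum.mono_neutral_right) (use n Bz in auto)
    then show "(\<Sum>j<n. A $$ (i, j) * P $$ (j, 0)) = c * P $$ (i, 0)"
      using APe[of i 0] i n B00 by simp
    have "(\<Sum>k<n. P $$ (i, k) * B $$ (k, 1)) = (\<Sum>k\<in>{0, 1}. P $$ (i, k) * B $$ (k, 1))"
      by (rule sum.mono_neutral_right) (use n Bz in auto)
    then show "(\<Sum>j<n. A $$ (i, j) * P $$ (j, 1)) = B $$ (0, 1) * P $$ (i, 0) + c * P $$ (i, 1)"
      using APe[of i 1] i n B11 by simp
  next
    fix s t assume z: "\<And>i. i < n \<Longrightarrow> s * P $$ (i, 0) + t * P $$ (i, 1) = 0"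
    \<comment> \<open>Applying \<open>Q\<close> to the vanishing combination lets rows 0 and 1 of
      \<open>Q * P = 1\<^sub>m n\<close> isolate \<open>s\<close> and \<open>t\<close>.\<close>
    have "s * (\<Sum>k<n. Q $$ (i, k) * P $$ (k, 0)) + t * (\<Sum>k<n. Q $$ (i, k) * P $$ (k, 1)) = 0" for i
    proof -
      have "s * (\<Sum>k<n. Q $$ (i, k) * P $$ (k, 0)) + t * (\<Sum>k<n. Q $$ (i, k) * P $$ (k, 1))
        = (\<Sum>k<n. Q $$ (i, k) * (s * P $$ (k, 0) + t * P $$ (k, 1)))"
        by (simp add: sum_distrib_left sum.distrib algebra_simps)
      then show ?thesis using z by simp
    qed
    from this[of 0] this[of 1] show "s = 0 \<and> t = 0" using n by (simp add: QPe)
  qed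
qed

section \<open>Poincare inequality and second eigenvalue\<close>

text \<open>After expanding the square, both pure squares reduce to the squared norm by the row
  sums, the second one after exchanging \<open>x\<close> and \<open>y\<close>. The right-hand side
  is twice the quadratic form of the identity minus \<open>H\<close>.\<close>

lemma dirichlet_form_eq:
  fixes H :: "'a \<Rightarrow> 'a \<Rightarrow> real"
  assumes sym: "\<And>x y. x \<in> \<Omega> \<Longrightarrow> y \<in> \<Omega> \<Longrightarrow> H x y = H y x"
    and row: "\<And>x. x \<in> \<Omega> \<Longrightarrow> (\<Sum>y\<in>\<Omega>. H x y) = 1"
  shows "(\<Sum>x\<in>\<Omega>. \<Sum>y\<in>\<Omega>. H x y * (\<phi> x - \<phi> y)\<^sup>2)
    = 2 * (\<Sum>x\<in>\<Omega>. (\<phi> x)\<^sup>2) - 2 * (\<Sum>x\<in>\<Omega>. \<phi> x * (\<Sum>y\<in>\<Omega>. H x y * \<phi> y))"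
proof -
  have 1: "(\<Sum>x\<in>\<Omega>. \<Sum>y\<in>\<Omega>. H x y * (\<phi> x)\<^sup>2) = (\<Sum>x\<in>\<Omega>. (\<phi> x)\<^sup>2)"
    by (simp add: sum_distrib_right[symmetric] row)
  have "(\<Sum>x\<in>\<Omega>. \<Sum>y\<in>\<Omega>. H x y * (\<phi> y)\<^sup>2) = (\<Sum>y\<in>\<Omega>. \<Sum>x\<in>\<Omega>. H x y * (\<phi> y)\<^sup>2)"
    by (rule sum.swap)
  also have "\<dots> = (\<Sum>x\<in>\<Omega>. \<Sum>y\<in>\<Omega>. H x y * (\<phi> x)\<^sup>2)"
    by (intro sum.cong) (auto simp: sym)
  finally have 2: "(\<Sum>x\<in>\<Omega>. \<Sum>y\<in>\<Omega>. H x y * (\<phi> y)\<^sup>2) = (\<Sum>x\<in>\<Omega>. (\<phi> x)\<^sup>2)"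
    using 1 by simp
  have "(\<Sum>x\<in>\<Omega>. \<Sum>y\<in>\<Omega>. H x y * (\<phi> x - \<phi> y)\<^sup>2)
    = (\<Sum>x\<in>\<Omega>. \<Sum>y\<in>\<Omega>. H x y * (\<phi> x)\<^sup>2 + H x y * (\<phi> y)\<^sup>2 - 2 * (\<phi> x * (H x y * \<phi> y)))"
    by (intro sum.cong refl) (simp add: power2_eq_square algebra_simps)
  also have "\<dots> = (\<Sum>x\<in>\<Omega>. (\<phi> x)\<^sup>2) + (\<Sum>x\<in>\<Omega>. (\<phi> x)\<^sup>2)
      - 2 * (\<Sum>x\<in>\<Omega>. \<phi> x * (\<Sum>y\<in>\<Omega>. H x y * \<phi> y))"
    by (simp add: sum.distrib sum_subtractf sum_distrib_left[symmetric] 1 2)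
  finally show ?thesis by simp
qed

text \<open>By symmetry the columns sum to 1 as well.\<close>

lemma sum_fixed_by_stochastic:
  fixes H :: "'a \<Rightarrow> 'a \<Rightarrow> real"
  assumes sym: "\<And>x y. x \<in> \<Omega> \<Longrightarrow> y \<in> \<Omega> \<Longrightarrow> H x y = H y x"
    and row: "\<And>x. x \<in> \<Omega> \<Longrightarrow> (\<Sum>y\<in>\<Omega>. H x y) = 1"
  shows "(\<Sum>x\<in>\<Omega>. \<Sum>y\<in>\<Omega>. H x y * \<phi> y) = (\<Sum>y\<in>\<Omega>. \<phi> y)"
proof -
  have "(\<Sum>x\<in>\<Omega>. \<Sum>y\<in>\<Omega>. H x y * \<phi> y) = (\<Sum>y\<in>\<Omega>. \<Sum>x\<in>\<Omega>. H x y * \<phi> y)"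
    by (rule sum.swap)
  also have "\<dots> = (\<Sum>y\<in>\<Omega>. \<Sum>x\<in>\<Omega>. H y x * \<phi> y)"
    by (intro sum.cong) (auto simp: sym)
  finally show ?thesis by (simp add: sum_distrib_right[symmetric] row)
qed

text \<open>\<open>poincare\<close> is a spectral gap in variational form and controls the second
  eigenvalue; \<open>psd\<close> controls the smallest one.\<close>

locale poincare_kernel =
  fixes \<Omega> :: "'a set" and H :: "'a \<Rightarrow> 'a \<Rightarrow> real" and K :: real
  assumes finite: "finite \<Omega>"
    and sym: "\<And>x y. x \<in> \<Omega> \<Longrightarrow> y \<in> \<Omega> \<Longrightarrow> H x y = H y x"
    and row: "\<And>x. x \<in> \<Omega> \<Longrightarrow> (\<Sum>y\<in>\<Omega>. H x y) = 1"
    and psd: "\<And>\<phi>. 0 \<le> (\<Sum>x\<in>\<Omega>. \<phi> x * (\<Sum>y\<in>\<Omega>. H x y * \<phi> y))"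
    and K_pos: "0 < K"
    and poincare: "\<And>\<phi>. (\<Sum>x\<in>\<Omega>. \<Sum>y\<in>\<Omega>. (\<phi> x - \<phi> y)\<^sup>2)
      \<le> K * (\<Sum>x\<in>\<Omega>. \<Sum>y\<in>\<Omega>. H x y * (\<phi> x - \<phi> y)\<^sup>2)"
begin

lemma sum_squares_pos:
  assumes "x \<in> \<Omega>" "\<phi> x \<noteq> (0 :: real)"
  shows "0 < (\<Sum>x\<in>\<Omega>. (\<phi> x)\<^sup>2)"
  using assms finite by (intro sum_pos2[of _ x]) auto

lemma eigen_form:
  assumes "\<And>x. x \<in> \<Omega> \<Longrightarrow> (\<Sum>y\<in>\<Omega>. H x y * \<phi> y) = a * \<phi> x"
  shows "(\<Sum>x\<in>\<Omega>. \<phi> x * (\<Sum>y\<in>\<Omega>. H x y * \<phi> y)) = a * (\<Sum>x\<in>\<Omega>. (\<phi> x)\<^sup>2)"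
  unfolding sum_distrib_left[of a] power2_eq_square
  by (rule sum.cong[OF refl]) (simp only: assms mult.left_commute)

lemma eigenvalue_nonneg:
  assumes "\<And>x. x \<in> \<Omega> \<Longrightarrow> (\<Sum>y\<in>\<Omega>. H x y * \<phi> y) = a * \<phi> x" "x \<in> \<Omega>" "\<phi> x \<noteq> 0"
  shows "0 \<le> a"
proof -
  have "0 \<le> a * (\<Sum>x\<in>\<Omega>. (\<phi> x)\<^sup>2)"
    using psd[of \<phi>] eigen_form[OF assms(1)] by simp
  then show ?thesis using sum_squares_pos[of x \<phi>, OF assms(2,3)] by (simp add: zero_le_mult_iff)
qed

text \<open>As \<open>H\<close> preserves sums and \<open>a \<noteq> 1\<close>, the values of
  \<open>\<phi>\<close> sum to 0. The two sides of \<open>poincare\<close> are then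
  \<open>2 * card \<Omega> * ?S\<close> and \<open>K * (2 * (1 - a) * ?S)\<close>.\<close>

lemma eigenvalue_le_if_not_1:
  assumes ev: "\<And>x. x \<in> \<Omega> \<Longrightarrow> (\<Sum>y\<in>\<Omega>. H x y * \<phi> y) = a * \<phi> x"
    and nz: "x \<in> \<Omega>" "\<phi> x \<noteq> 0" and "a \<noteq> 1"
  shows "a \<le> 1 - card \<Omega> / K"
proof -
  let ?S = "\<Sum>x\<in>\<Omega>. (\<phi> x)\<^sup>2"
  have "(\<Sum>x\<in>\<Omega>. \<phi> x) = a * (\<Sum>x\<in>\<Omega>. \<phi> x)"
    using sum_fixed_by_stochastic[of \<Omega> H \<phi>, OF sym row] ev by (simp add: sum_distrib_left)
  then have sum0: "(\<Sum>x\<in>\<Omega>. \<phi> x) = 0" using \<open>a \<noteq> 1\<close> by simp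
  have "(\<Sum>x\<in>\<Omega>. \<Sum>y\<in>\<Omega>. (\<phi> x - \<phi> y)\<^sup>2)
    = (\<Sum>x\<in>\<Omega>. \<Sum>y\<in>\<Omega>. (\<phi> x)\<^sup>2 + (\<phi> y)\<^sup>2 - 2 * (\<phi> x * \<phi> y))"
    by (intro sum.cong refl) (simp add: power2_eq_square algebra_simps)
  also have "\<dots> = 2 * card \<Omega> * ?S"
    by (simp add: sum.distrib sum_subtractf sum_distrib_left[symmetric] sum0)
  finally have "2 * card \<Omega> * ?S \<le> K * (\<Sum>x\<in>\<Omega>. \<Sum>y\<in>\<Omega>. H x y * (\<phi> x - \<phi> y)\<^sup>2)"
    using poincare[of \<phi>] by simp
  also have "(\<Sum>x\<in>\<Omega>. \<Sum>y\<in>\<Omega>. H x y * (\<phi> x - \<phi> y)\<^sup>2) = 2 * (1 - a) * ?S"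
    using dirichlet_form_eq[of \<Omega> H \<phi>, OF sym row] eigen_form[OF ev]
    by (simp add: left_diff_distrib)
  finally have "card \<Omega> * ?S \<le> (K * (1 - a)) * ?S" by (simp add: algebra_simps)
  then have "card \<Omega> \<le> K * (1 - a)"
    using sum_squares_pos[of x \<phi>, OF nz] by (simp only: mult_le_cancel_right_pos)
  then show ?thesis using K_pos by (simp add: field_simps)
qed

text \<open>The Dirichlet form of a fixed function is 0, so \<open>poincare\<close> makes all
  differences vanish.\<close>

lemma fixed_const:
  assumes ev: "\<And>x. x \<in> \<Omega> \<Longrightarrow> (\<Sum>y\<in>\<Omega>. H x y * \<phi> y) = \<phi> x"
    and "x \<in> \<Omega>" "y \<in> \<Omega>"
  shows "\<phi> x = \<phi> y"
proof -
  have "(\<Sum>x\<in>\<Omega>. \<Sum>y\<in>\<Omega>. H x y * (\<phi> x - \<phi> y)\<^sup>2) = 0"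
    using dirichlet_form_eq[of \<Omega> H \<phi>, OF sym row] ev by (simp add: power2_eq_square)
  then have "(\<Sum>x\<in>\<Omega>. \<Sum>y\<in>\<Omega>. (\<phi> x - \<phi> y)\<^sup>2) \<le> 0" using poincare[of \<phi>] by simp
  moreover have "(\<phi> x - \<phi> y)\<^sup>2 \<le> (\<Sum>y\<in>\<Omega>. (\<phi> x - \<phi> y)\<^sup>2)"
    by (rule member_le_sum) (use assms finite in auto)
  moreover have "\<dots> \<le> (\<Sum>x\<in>\<Omega>. \<Sum>y\<in>\<Omega>. (\<phi> x - \<phi> y)\<^sup>2)"
    by (rule member_le_sum) (use assms finite in \<open>auto intro: sum_nonneg\<close>)
  ultimately have "(\<phi> x - \<phi> y)\<^sup>2 \<le> 0" by linarith
  then show ?thesis by simp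
qed

text \<open>All eigenvalues are nonnegative, so \<open>- last ls\<close> cannot exceed the second
  entry. Entries other than 1 obey the bound, so it remains to see that the second entry is not
  1.\<close>

theorem second_eigenvalue_modulus_le:
  assumes card: "card \<Omega> \<ge> 2"
  shows "second_eigenvalue_modulus (matrix_on \<Omega> H) \<le> 1 - card \<Omega> / K"
proof -
  define n where "n = card \<Omega>"
  define A where "A = matrix_on \<Omega> H"
  let ?e = "from_nat_into \<Omega>"
  have bij: "bij_betw ?e {..<n} \<Omega>"
    unfolding n_def by (rule bij_betw_from_nat_into_finite[OF finite])
  \<comment> \<open>\<open>d\<close> inverts the enumeration \<open>?e\<close> and turns a vector
    \<open>v\<close> on \<open>{..<n}\<close> into the function \<open>v (d x)\<close> on
    \<open>\<Omega>\<close>.\<close>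
  define d where "d = inv_into {..<n} ?e"
  have ed: "?e (d x) = x" "d x < n" if "x \<in> \<Omega>" for x
    using bij_betw_inv_into_right[OF bij that] bij_betwE[OF bij_betw_inv_into[OF bij]] that
    by (auto simp: d_def)
  have de: "d (?e i) = i" "?e i \<in> \<Omega>" if "i < n" for i
    using bij_betw_inv_into_left[OF bij] bij_betwE[OF bij] that by (auto simp: d_def)
  have A: "A \<in> carrier_mat n n" by (simp add: A_def matrix_on_def n_def)
  have Ae: "A $$ (i, j) = H (?e i) (?e j)" if "i < n" "j < n" for i j
    using that by (simp add: A_def matrix_on_def n_def)
  have sums: "(\<Sum>i<n. h (?e i)) = (\<Sum>x\<in>\<Omega>. h x)" for h :: "'a \<Rightarrow> real"
    unfolding n_def by (rule sum.card_from_nat_into)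
  have mult: "(\<Sum>y\<in>\<Omega>. H x y * v (d y)) = (\<Sum>j<n. A $$ (d x, j) * v j)" if "x \<in> \<Omega>" for x v
    unfolding sums[symmetric] by (rule sum.cong) (use that ed de Ae in auto)
  obtain ls where ls: "sorted_wrt (\<ge>) ls" "char_poly A = (\<Prod>a\<leftarrow>ls. [:- a, 1:])"
  proof (rule char_poly_splits_if_symmetric[OF A])
    show "A $$ (i, j) = A $$ (j, i)" if "i < n" "j < n" for i j
      using that by (simp add: Ae de sym)
  qed
  have len: "length ls = n"
    using degree_monic_char_poly[OF A] degree_linear_factors[of uminus ls] ls(2) by simp
  have ev: "\<exists>\<phi> x. x \<in> \<Omega> \<and> \<phi> x \<noteq> 0 \<and> (\<forall>x\<in>\<Omega>. (\<Sum>y\<in>\<Omega>. H x y * \<phi> y) = a * \<phi> x)"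
    if "a \<in> set ls" for a
  proof -
    have "poly (char_poly A) a = 0"
      unfolding ls(2) poly_prod_list using that by (auto simp: prod_list_zero_iff)
    then have "eigenvalue A a" using eigenvalue_root_char_poly[OF A] by blast
    then obtain v where v: "v \<in> carrier_vec n" "v \<noteq> 0\<^sub>v n" "A *\<^sub>v v = a \<cdot>\<^sub>v v"
      using A unfolding eigenvalue_def eigenvector_def by auto
    obtain i where i: "i < n" "vec_index v i \<noteq> 0"
      using v by (metis carrier_vecD eq_vecI index_zero_vec)
    have "(\<Sum>j<n. A $$ (i, j) * vec_index v j) = a * vec_index v i" if "i < n" for i
      using arg_cong[OF v(3), of "\<lambda>w. vec_index w i"] that A v(1)
      by (simp add: scalar_prod_def lessThan_atLeast0)
    then have "\<forall>x\<in>\<Omega>. (\<Sum>y\<in>\<Omega>. H x y * vec_index v (d y)) = a * vec_index v (d x)"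
      by (simp add: mult ed)
    moreover have "vec_index v (d (?e i)) \<noteq> 0" "?e i \<in> \<Omega>" using i de[OF i(1)] by simp_all
    ultimately show ?thesis
      by (intro exI[of _ "\<lambda>x. vec_index v (d x)"] exI[of _ "?e i"] conjI)
  qed
  have nonneg: "0 \<le> a" if "a \<in> set ls" for a
    using ev[OF that] eigenvalue_nonneg by blast
  have le: "a \<le> 1 - card \<Omega> / K" if "a \<in> set ls" "a \<noteq> 1" for a
    using ev[OF that(1)] eigenvalue_le_if_not_1 that(2) by blast
  obtain a b as where abs: "ls = a # b # as"
    using len card n_def by (metis One_nat_def Suc_1 Suc_le_length_iff)
  \<comment> \<open>If 1 were a double root, a Schur basis would start with \<open>v\<close>, \<open>w\<close> where \<open>H v = v\<close> and
    \<open>H w = c v + w\<close>. As \<open>v\<close> is constant and \<open>H\<close> preserves sums, \<open>c = 0\<close>, so \<open>w\<close> is constant too.\<close>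
  have "b \<noteq> 1"
  proof
    assume b: "b = 1"
    have lt: "1 - card \<Omega> / K < 1" using K_pos card by simp
    have "1 \<le> a" using ls(1) b abs by simp
    then have "a = 1"
      using le[of a] lt abs by fastforce
    with b abs ls(2) have "char_poly A = (\<Prod>a\<leftarrow>1 # 1 # as. [:- a, 1:])" by simp
    from repeated_root_generalized_eigenvectors[OF A this]
    obtain v w c where v: "\<And>i. i < n \<Longrightarrow> (\<Sum>j<n. A $$ (i, j) * v j) = v i"
      and w: "\<And>i. i < n \<Longrightarrow> (\<Sum>j<n. A $$ (i, j) * w j) = c * v i + w i"
      and indep: "\<And>s t. (\<And>i. i < n \<Longrightarrow> s * v i + t * w i = 0) \<Longrightarrow> s = 0 \<and> t = 0"
      by (simp only: mult_1) blast
    have const: "u i = u 0" if "\<And>i. i < n \<Longrightarrow> (\<Sum>j<n. A $$ (i, j) * u j) = u i" "i < n" for u i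
    proof -
      have "u (d (?e i)) = u (d (?e 0))"
      proof (rule fixed_const[of "\<lambda>x. u (d x)"])
        show "(\<Sum>y\<in>\<Omega>. H x y * u (d y)) = u (d x)" if "x \<in> \<Omega>" for x
          using mult[OF that, of u] \<open>\<And>i. i < n \<Longrightarrow> (\<Sum>j<n. A $$ (i, j) * u j) = u i\<close>[OF ed(2)[OF that]]
          by simp
      qed (use de card n_def that in auto)
      then show ?thesis using de(1)[of i] de(1)[of 0] that by simp
    qed
    have cv: "v i = v 0" if "i < n" for i
      by (rule const[OF v that])
    have v0: "v 0 \<noteq> 0"
    proof
      assume "v 0 = 0"
      then have "1 * v i + 0 * w i = 0" if "i < n" for i unfolding cv[OF that] by simp
      from indep[OF this] show False by simp
    qed
    have "(\<Sum>x\<in>\<Omega>. c * v (d x) + w (d x)) = (\<Sum>x\<in>\<Omega>. w (d x))"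
      using sum_fixed_by_stochastic[of \<Omega> H "\<lambda>x. w (d x)", OF sym row] by (simp add: mult w ed)
    then have "(\<Sum>x\<in>\<Omega>. c * v (d x)) = 0" by (simp add: sum.distrib)
    moreover have "(\<Sum>x\<in>\<Omega>. c * v (d x)) = (\<Sum>x\<in>\<Omega>. c * v 0)"
      by (intro sum.cong refl) (use cv ed in auto)
    ultimately have "c = 0" using v0 card by (auto simp: card_eq_0_iff)
    then have cw: "w i = w 0" if "i < n" for i
      using const[of w i] w that by (simp only: mult_zero_left add_0)
    \<comment> \<open>Both vectors are constant, so cross-multiplying their values gives a linear
      relation, nontrivial because \<open>v 0 \<noteq> 0\<close>.\<close>
    have "w 0 * v i + (- v 0) * w i = 0" if "i < n" for i
      unfolding cv[OF that] cw[OF that] by simp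
    from indep[OF this] v0 show False by simp
  qed
  then have "ls ! 1 \<le> 1 - card \<Omega> / K" using le[of b] abs by simp
  moreover have "- last ls \<le> ls ! 1"
    using nonneg[of "last ls"] nonneg[of b] abs by (auto split: if_splits)
  ultimately show ?thesis
    using eigenvalues_desc_eqI[OF ls]
    by (simp add: second_eigenvalue_modulus_def A_def[symmetric])
qed

end

section \<open>Heat-bath moves along rays\<close>

lemma ray_subset: "ray F x m \<subseteq> F"
  by (auto simp: ray_def)

lemma finite_ray: "finite F \<Longrightarrow> finite (ray F x m)"
  by (rule finite_subset[OF ray_subset])

lemma mem_ray_self: "x \<in> F \<Longrightarrow> x \<in> ray F x m"
  unfolding ray_def by (auto intro!: exI[of _ 0])

text \<open>Rays are the traces on \<open>F\<close> of cosets of the subgroup generated by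
  \<open>m\<close>, so the rays through nodes of \<open>F\<close> partition
  \<open>F\<close>.\<close>

lemma ray_eq_if_mem:
  assumes "y \<in> ray F x m"
  shows "ray F y m = ray F x m"
proof -
  obtain l where y: "y = x + l *s m" using assms by (auto simp: ray_def)
  have "y + a *s m = x + (l + a) *s m" "x + a *s m = y + (a - l) *s m" for a
    unfolding y by (simp_all add: Finite_Cartesian_Product.vec_eq_iff vector_scalar_mult_def algebra_simps)
  then have "{y + a *s m | a. True} = {x + a *s m | a. True}"
    by (metis (mono_tags, lifting))
  then show ?thesis by (simp add: ray_def)
qed

lemma ray_sym: "x \<in> F \<Longrightarrow> y \<in> ray F x m \<Longrightarrow> x \<in> ray F y m"
  using ray_eq_if_mem mem_ray_self by blast

text \<open>Lying on a common ray is a symmetric relation on \<open>F\<close>.\<close>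

lemma sum_ray_swap:
  fixes g :: "int ^ 'd \<Rightarrow> int ^ 'd \<Rightarrow> real"
  assumes "finite F"
  shows "(\<Sum>x\<in>F. \<Sum>y\<in>ray F x m. g x y) = (\<Sum>y\<in>F. \<Sum>x\<in>ray F y m. g x y)"
proof -
  have *: "(\<Sum>y\<in>ray F x m. h y) = (\<Sum>y\<in>F. if y \<in> ray F x m then h y else 0)" for x and h :: "_ \<Rightarrow> real"
    using assms ray_subset[of F x m] by (simp add: sum.If_cases Int_absorb1)
  have "(\<Sum>x\<in>F. \<Sum>y\<in>ray F x m. g x y) = (\<Sum>y\<in>F. \<Sum>x\<in>F. if y \<in> ray F x m then g x y else 0)"
    unfolding * by (rule sum.swap)
  also have "\<dots> = (\<Sum>y\<in>F. \<Sum>x\<in>F. if x \<in> ray F y m then g x y else 0)"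
    by (intro sum.cong refl if_cong iffI) (simp_all add: ray_sym)
  finally show ?thesis unfolding * .
qed

lemma heat_bath_move_uniform:
  assumes "finite F" "x \<in> F"
  shows "heat_bath_move F (uniform_mass F) m x y
    = (if y \<in> ray F x m then 1 / real (card (ray F x m)) else 0)"
proof -
  have "card F > 0" using assms by (auto simp: card_gt_0_iff)
  then show ?thesis by (simp add: heat_bath_move_def uniform_mass_def)
qed

lemma sum_heat_bath_move_uniform:
  assumes "finite F" "x \<in> F"
  shows "(\<Sum>y\<in>F. heat_bath_move F (uniform_mass F) m x y * g y)
    = (\<Sum>y\<in>ray F x m. g y) / card (ray F x m)"
proof -
  have "(\<Sum>y\<in>F. heat_bath_move F (uniform_mass F) m x y * g y)
    = (\<Sum>y\<in>F. if y \<in> ray F x m then g y / card (ray F x m) else 0)"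
    by (intro sum.cong refl) (simp add: heat_bath_move_uniform[OF assms])
  also have "\<dots> = (\<Sum>y\<in>ray F x m. g y / card (ray F x m))"
    using assms ray_subset[of F x m] by (simp add: sum.If_cases Int_absorb1)
  finally show ?thesis by (simp add: sum_divide_distrib)
qed

lemma card_ray_pos: "finite F \<Longrightarrow> x \<in> F \<Longrightarrow> card (ray F x m) > 0"
  using mem_ray_self finite_ray by (fastforce simp: card_gt_0_iff)

lemma heat_bath_move_uniform_sym:
  assumes "finite F" "x \<in> F" "y \<in> F"
  shows "heat_bath_move F (uniform_mass F) m x y = heat_bath_move F (uniform_mass F) m y x"
proof (cases "y \<in> ray F x m")
  case True
  then show ?thesis
    using assms ray_sym[OF assms(2) True] ray_eq_if_mem[OF True] by (simp add: heat_bath_move_uniform)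
next
  case False
  then have "x \<notin> ray F y m" using ray_sym assms by blast
  then show ?thesis using assms False by (simp add: heat_bath_move_uniform)
qed

text \<open>The move replaces \<open>\<phi>\<close> by its ray averages \<open>g\<close>, and the
  form equals the squared norm of \<open>g\<close>.\<close>

lemma heat_bath_move_uniform_psd:
  assumes F: "finite F"
  shows "0 \<le> (\<Sum>x\<in>F. \<phi> x * (\<Sum>y\<in>F. heat_bath_move F (uniform_mass F) m x y * \<phi> y))"
proof -
  define c where "c x = real (card (ray F x m))" for x
  define g where "g x = (\<Sum>y\<in>ray F x m. \<phi> y) / c x" for x
  have c: "c y = c x" "g y = g x" if "y \<in> ray F x m" for x y
    using ray_eq_if_mem[OF that] by (simp_all add: c_def g_def)
  have cpos: "c x > 0" if "x \<in> F" for x using card_ray_pos[OF F that] by (simp add: c_def)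
  \<comment> \<open>One factor of the square is expanded as a ray average of \<open>\<phi>\<close>.
    After the swap, \<open>g\<close> and \<open>c\<close> are constant on the ray of
    \<open>y\<close>, whose \<open>c y\<close> points cancel the denominator.\<close>
  have "(\<Sum>x\<in>F. (g x)\<^sup>2) = (\<Sum>x\<in>F. \<Sum>y\<in>ray F x m. \<phi> y * g x / c x)"
    by (simp add: g_def power2_eq_square sum_divide_distrib sum_distrib_right)
  also have "\<dots> = (\<Sum>y\<in>F. \<Sum>x\<in>ray F y m. \<phi> y * g x / c x)" by (rule sum_ray_swap[OF F])
  also have "\<dots> = (\<Sum>y\<in>F. \<Sum>x\<in>ray F y m. \<phi> y * g y / c y)"
    by (intro sum.cong refl) (simp add: c)
  also have "\<dots> = (\<Sum>y\<in>F. \<phi> y * g y)"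
    by (rule sum.cong) (use cpos in \<open>force simp: c_def[symmetric]\<close>)+
  finally have "0 \<le> (\<Sum>y\<in>F. \<phi> y * g y)"
    by (metis (no_types, lifting) sum_nonneg zero_le_power2)
  then show ?thesis
    by (simp add: sum_heat_bath_move_uniform[OF F] g_def c_def)
qed

text \<open>The Dirichlet form of a single move, over ordered pairs and without the usual factor
  1/2. Separating the moves lets \<open>f\<close> enter only at the end, through its
  minimum.\<close>

definition dirichlet_move :: "(int ^ 'd) set \<Rightarrow> (int ^ 'd \<Rightarrow> real) \<Rightarrow> int ^ 'd \<Rightarrow> real" where
  "dirichlet_move F \<phi> m =
    (\<Sum>x\<in>F. \<Sum>y\<in>F. heat_bath_move F (uniform_mass F) m x y * (\<phi> x - \<phi> y)\<^sup>2)"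

lemma dirichlet_move_nonneg: "0 \<le> dirichlet_move F \<phi> m"
  unfolding dirichlet_move_def heat_bath_move_def uniform_mass_def
  by (intro sum_nonneg mult_nonneg_nonneg) (auto intro!: sum_nonneg divide_nonneg_nonneg)

text \<open>A pair on a ray of size \<open>s\<close> has weight \<open>1 / s\<close> in the
  Dirichlet form, and \<open>s \<le> c\<close>.\<close>

lemma sum_ray_le_dirichlet_move:
  assumes F: "finite F" and c: "\<And>x. x \<in> F \<Longrightarrow> card (ray F x m) \<le> c"
  shows "(\<Sum>x\<in>F. \<Sum>y\<in>ray F x m. (\<phi> x - \<phi> y)\<^sup>2) \<le> real c * dirichlet_move F \<phi> m"
proof -
  have "(\<Sum>y\<in>ray F x m. (\<phi> x - \<phi> y)\<^sup>2)
      \<le> c * ((\<Sum>y\<in>ray F x m. (\<phi> x - \<phi> y)\<^sup>2) / card (ray F x m))" if "x \<in> F" for x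
  proof -
    have "card (ray F x m) * (\<Sum>y\<in>ray F x m. (\<phi> x - \<phi> y)\<^sup>2)
        \<le> c * (\<Sum>y\<in>ray F x m. (\<phi> x - \<phi> y)\<^sup>2)"
      by (intro mult_right_mono sum_nonneg) (use c[OF that] in auto)
    then show ?thesis using card_ray_pos[OF F that, of m] by (simp add: field_simps)
  qed
  then show ?thesis
    by (simp add: dirichlet_move_def sum_heat_bath_move_uniform[OF F] sum_distrib_left sum_mono)
qed

section \<open>Walks along a list of moves\<close>

text \<open>The possible ends of walks that use the moves in this order, each step going to any node
  of the current ray. Being a set, it counts an end once, however many walks lead there.\<close>

primrec reach :: "(int ^ 'd) set \<Rightarrow> (int ^ 'd) list \<Rightarrow> int ^ 'd \<Rightarrow> (int ^ 'd) set" where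
  "reach F [] x = {x}"
| "reach F (m # \<sigma>) x = (\<Union>z\<in>ray F x m. reach F \<sigma> z)"

lemma finite_reach: "finite F \<Longrightarrow> finite (reach F \<sigma> x)"
  by (induction \<sigma> arbitrary: x) (auto intro: finite_ray)

text \<open>Each step has at most \<open>c m\<close> choices, so the product bounds the number of
  walks.\<close>

lemma card_reach_le:
  assumes F: "finite F" and c: "\<And>m x. m \<in> set \<sigma> \<Longrightarrow> x \<in> F \<Longrightarrow> card (ray F x m) \<le> c m"
    and "x \<in> F"
  shows "card (reach F \<sigma> x) \<le> (\<Prod>m\<leftarrow>\<sigma>. c m)"
  using c \<open>x \<in> F\<close>
proof (induction \<sigma> arbitrary: x)
  case (Cons m \<sigma>)
  have "card (reach F (m # \<sigma>) x) \<le> (\<Sum>z\<in>ray F x m. card (reach F \<sigma> z))"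
    by (simp add: card_UN_le finite_ray F)
  also have "\<dots> \<le> (\<Sum>z\<in>ray F x m. \<Prod>m\<leftarrow>\<sigma>. c m)"
    by (rule sum_mono) (use Cons ray_subset in fastforce)
  also have "\<dots> \<le> c m * (\<Prod>m\<leftarrow>\<sigma>. c m)"
    using Cons.prems by simp
  finally show ?case by simp
qed simp

lemma sum_UN_le:
  fixes g :: "'b \<Rightarrow> real"
  assumes "finite I" "\<And>i. finite (B i)" "\<And>y. 0 \<le> g y"
  shows "(\<Sum>y\<in>(\<Union>i\<in>I. B i). g y) \<le> (\<Sum>i\<in>I. \<Sum>y\<in>B i. g y)"
proof -
  have "(\<Union>i\<in>I. B i) = snd ` Sigma I B" by force
  then have "(\<Sum>y\<in>(\<Union>i\<in>I. B i). g y) \<le> (\<Sum>p\<in>Sigma I B. g (snd p))"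
    using sum_image_le[of "Sigma I B" g snd] assms by (simp add: o_def)
  also have "\<dots> = (\<Sum>i\<in>I. \<Sum>y\<in>B i. g y)"
    using assms by (simp add: sum.Sigma case_prod_beta)
  finally show ?thesis .
qed

text \<open>Induction on \<open>\<sigma>\<close>, splitting each difference at the node
  \<open>z\<close> after the first step. The part from \<open>x\<close> to \<open>z\<close> recurs
  for at most \<open>p\<close> ends, the part from \<open>z\<close> to \<open>y\<close> for at most
  \<open>c m\<close> starting points, so both parts carry the same product of ray lengths.\<close>

lemma sum_reach_le:
  assumes F: "finite F" and c: "\<And>m x. m \<in> set \<sigma> \<Longrightarrow> x \<in> F \<Longrightarrow> card (ray F x m) \<le> c m"
  shows "(\<Sum>x\<in>F. \<Sum>y\<in>reach F \<sigma> x. (\<phi> x - \<phi> y)\<^sup>2)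
    \<le> length \<sigma> * real (\<Prod>m\<leftarrow>\<sigma>. c m) * (\<Sum>m\<leftarrow>\<sigma>. dirichlet_move F \<phi> m)"
  using c
proof (induction \<sigma>)
  case (Cons m \<sigma>)
  define s where "s = real (length \<sigma>)"
  define p where "p = real (\<Prod>m\<leftarrow>\<sigma>. c m)"
  define E where "E = (\<Sum>m\<leftarrow>\<sigma>. dirichlet_move F \<phi> m)"
  define D where "D z = (\<Sum>y\<in>reach F \<sigma> z. (\<phi> z - \<phi> y)\<^sup>2)" for z
  have D0: "0 \<le> D z" for z by (simp add: D_def sum_nonneg)
  have sD: "(\<Sum>z\<in>F. D z) \<le> s * p * E"
    using Cons unfolding D_def s_def p_def E_def by simp
  have s0: "0 \<le> s" and p0: "0 \<le> p" by (simp_all add: s_def p_def)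
  have pE: "0 \<le> p * E"
    using p0 unfolding E_def by (intro mult_nonneg_nonneg sum_list_nonneg) (auto simp: dirichlet_move_nonneg)
  \<comment> \<open>The weights \<open>s + 1\<close> and \<open>(s + 1) / s\<close> in Young's inequality make the constants telescope to
    \<open>length \<sigma>\<close>. For \<open>s = 0\<close> the junk value \<open>D z / 0 = 0\<close> is right, since then \<open>D z = 0\<close>.\<close>
  have step: "(\<Sum>y\<in>reach F \<sigma> z. (\<phi> x - \<phi> y)\<^sup>2) \<le> (s + 1) * (p * (\<phi> x - \<phi> z)\<^sup>2 + D z / s)"
    if "z \<in> F" for x z
  proof (cases "\<sigma> = []")
    case True
    then show ?thesis by (simp add: s_def p_def D_def)
  next
    case False
    then have s: "s > 0" by (simp add: s_def)
    have young: "(\<phi> x - \<phi> y)\<^sup>2 \<le> (s + 1) * ((\<phi> x - \<phi> z)\<^sup>2 + (\<phi> z - \<phi> y)\<^sup>2 / s)" for y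
    proof -
      have "s * ((s + 1) * ((\<phi> x - \<phi> z)\<^sup>2 + (\<phi> z - \<phi> y)\<^sup>2 / s) - (\<phi> x - \<phi> y)\<^sup>2)
        = (s * (\<phi> x - \<phi> z) - (\<phi> z - \<phi> y))\<^sup>2"
        using s by (simp add: field_simps power2_eq_square)
      then have "0 \<le> s * ((s + 1) * ((\<phi> x - \<phi> z)\<^sup>2 + (\<phi> z - \<phi> y)\<^sup>2 / s) - (\<phi> x - \<phi> y)\<^sup>2)"
        by simp
      then show ?thesis using s by (simp add: zero_le_mult_iff)
    qed
    have "(\<Sum>y\<in>reach F \<sigma> z. (\<phi> x - \<phi> y)\<^sup>2)
        \<le> (\<Sum>y\<in>reach F \<sigma> z. (s + 1) * ((\<phi> x - \<phi> z)\<^sup>2 + (\<phi> z - \<phi> y)\<^sup>2 / s))"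
      by (rule sum_mono) (rule young)
    also have "\<dots> = (s + 1) * (card (reach F \<sigma> z) * (\<phi> x - \<phi> z)\<^sup>2 + D z / s)"
      by (simp add: D_def sum.distrib sum_distrib_left[symmetric] sum_divide_distrib)
    also have "\<dots> \<le> (s + 1) * (p * (\<phi> x - \<phi> z)\<^sup>2 + D z / s)"
    proof -
      have "real (card (reach F \<sigma> z)) \<le> p"
        unfolding p_def using card_reach_le[OF F, of \<sigma> c z] Cons.prems that by force
      then show ?thesis using s by (intro mult_left_mono add_right_mono mult_right_mono) auto
    qed
    finally show ?thesis .
  qed
  have "(\<Sum>x\<in>F. \<Sum>y\<in>reach F (m # \<sigma>) x. (\<phi> x - \<phi> y)\<^sup>2)
      \<le> (\<Sum>x\<in>F. \<Sum>z\<in>ray F x m. \<Sum>y\<in>reach F \<sigma> z. (\<phi> x - \<phi> y)\<^sup>2)"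
    unfolding reach.simps by (intro sum_mono sum_UN_le finite_ray finite_reach F) simp
  also have "\<dots> \<le> (\<Sum>x\<in>F. \<Sum>z\<in>ray F x m. (s + 1) * (p * (\<phi> x - \<phi> z)\<^sup>2 + D z / s))"
    by (intro sum_mono step) (use ray_subset in blast)
  also have "\<dots> = (s + 1) * (p * (\<Sum>x\<in>F. \<Sum>z\<in>ray F x m. (\<phi> x - \<phi> z)\<^sup>2)
      + (\<Sum>x\<in>F. \<Sum>z\<in>ray F x m. D z) / s)"
    by (simp add: sum.distrib sum_distrib_left[symmetric] sum_divide_distrib[symmetric])
  \<comment> \<open>A fixed \<open>z\<close> is the first node for exactly
    \<open>card (ray F z m)\<close> starting points \<open>x\<close>.\<close>
  also have "(\<Sum>x\<in>F. \<Sum>z\<in>ray F x m. D z) = (\<Sum>z\<in>F. card (ray F z m) * D z)"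
    by (subst sum_ray_swap[OF F]) simp
  also have "(s + 1) * (p * (\<Sum>x\<in>F. \<Sum>z\<in>ray F x m. (\<phi> x - \<phi> z)\<^sup>2)
      + (\<Sum>z\<in>F. card (ray F z m) * D z) / s)
    \<le> (s + 1) * (p * (c m * dirichlet_move F \<phi> m) + c m * (p * E))"
  proof (intro mult_left_mono add_mono)
    show "(\<Sum>x\<in>F. \<Sum>z\<in>ray F x m. (\<phi> x - \<phi> z)\<^sup>2) \<le> c m * dirichlet_move F \<phi> m"
      by (rule sum_ray_le_dirichlet_move[OF F]) (use Cons.prems in auto)
    have "(\<Sum>z\<in>F. card (ray F z m) * D z) \<le> (\<Sum>z\<in>F. c m * D z)"
      by (intro sum_mono mult_right_mono D0) (use Cons.prems in auto)
    also have "\<dots> \<le> c m * (s * p * E)"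
      using sD by (simp add: sum_distrib_left[symmetric] mult_left_mono)
    finally have *: "(\<Sum>z\<in>F. card (ray F z m) * D z) / s \<le> c m * (s * p * E) / s"
      using s0 by (rule divide_right_mono)
    show "(\<Sum>z\<in>F. card (ray F z m) * D z) / s \<le> c m * (p * E)"
    proof (cases "s = 0")
      case False
      then show ?thesis using * by simp
    qed (use pE in simp)
  qed (use s0 p0 in auto)
  also have "\<dots> = length (m # \<sigma>) * real (\<Prod>m\<leftarrow>m # \<sigma>. c m) * (\<Sum>m\<leftarrow>m # \<sigma>. dirichlet_move F \<phi> m)"
    by (simp add: s_def p_def E_def algebra_simps)
  finally show ?case .
qed simp

lemma path_end_mem_reach:
  assumes "\<And>j. j \<le> length ps \<Longrightarrow> path_node u ps j \<in> F"
  shows "path_node u ps (length ps) \<in> reach F (map snd ps) u"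
  using assms
proof (induction ps arbitrary: u)
  case (Cons p ps)
  obtain l m where p: "p = (l, m)" by (cases p)
  have shift: "path_node u (p # ps) (Suc j) = path_node (u + l *s m) ps j" for j
    by (simp add: path_node_def p add.assoc)
  have "path_node (u + l *s m) ps j \<in> F" if "j \<le> length ps" for j
    using Cons.prems[of "Suc j"] that by (simp add: shift)
  note * = this Cons.IH[OF this]
  have "u + l *s m \<in> ray F u m"
    using *(1)[of 0] by (auto simp: ray_def path_node_def)
  then show ?case using *(2) shift[of "length ps"] by (auto simp: p)
qed (simp add: path_node_def)

text \<open>Every node lies in \<open>F\<close>: node \<open>j\<close> as the source of an edge of
  the compression, the last one as \<open>v\<close>.\<close>

lemma augmenting_path_mem_reach:
  assumes "augmenting_path F M u v ps"
  shows "v \<in> reach F (map snd ps) u"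
proof -
  have "path_node u ps j \<in> F" if "j \<le> length ps" for j
  proof (cases "j < length ps")
    case True
    then show ?thesis using assms by (auto simp: augmenting_path_def compression_def fiber_graph_def)
  next
    case False
    then show ?thesis using assms that by (auto simp: augmenting_path_def)
  qed
  then show ?thesis using path_end_mem_reach[of ps u F] assms by (auto simp: augmenting_path_def)
qed

section \<open>Counting lists of moves and summing over them\<close>

definition move_orders :: "'a set \<Rightarrow> nat \<Rightarrow> 'a list set" where
  "move_orders M L = {\<sigma>. set \<sigma> \<subseteq> M \<and> distinct \<sigma> \<and> length \<sigma> \<le> L}"

lemma move_orders_eq: "move_orders M L = (\<Union>S\<in>{S\<in>Pow M. card S \<le> L}. permutations_of_set S)"
  by (auto simp: move_orders_def permutations_of_set_def distinct_card)

text \<open>There are at most \<open>2 ^ card M\<close> sets of moves, and a set of at most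
  \<open>L\<close> moves has at most \<open>L!\<close> orders. Orders are told apart because every
  intermediate node has to lie in \<open>F\<close>.\<close>

lemma
  assumes "finite M"
  shows finite_move_orders: "finite (move_orders M L)"
    and card_move_orders_le: "card (move_orders M L) \<le> 2 ^ card M * fact L"
proof -
  show "finite (move_orders M L)"
    unfolding move_orders_eq using assms by (auto intro: finite_subset)
  have "card (move_orders M L) \<le> (\<Sum>S\<in>{S\<in>Pow M. card S \<le> L}. card (permutations_of_set S))"
    unfolding move_orders_eq by (rule card_UN_le) (use assms in auto)
  also have "\<dots> \<le> (\<Sum>S\<in>{S\<in>Pow M. card S \<le> L}. fact L)"
  proof (rule sum_mono)
    fix S assume "S \<in> {S\<in>Pow M. card S \<le> L}"
    then show "card (permutations_of_set S) \<le> fact L"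
      using assms finite_subset[of S M] by (auto intro: fact_mono)
  qed
  also have "\<dots> \<le> (\<Sum>S\<in>Pow M. fact L)"
    by (rule sum_mono2) (use assms in auto)
  finally show "card (move_orders M L) \<le> 2 ^ card M * fact L"
    using assms by (simp add: card_Pow)
qed

text \<open>The largest index in \<open>S\<close> is at least \<open>card S\<close>, so its factor
  is at most \<open>r (card S)\<close>; the remaining indices are treated by induction.\<close>

lemma prod_le_prod_initial_segment:
  fixes r :: "nat \<Rightarrow> nat"
  assumes "finite S" "S \<subseteq> {1..k}"
    and mono: "\<And>i j. 1 \<le> i \<Longrightarrow> i \<le> j \<Longrightarrow> j \<le> k \<Longrightarrow> r j \<le> r i"
  shows "(\<Prod>i\<in>S. r i) \<le> (\<Prod>i=1..card S. r i)"
  using assms(1,2)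
proof (induction S rule: finite_linorder_max_induct)
  case (insert b S)
  have "S \<subseteq> {1..<b}" using insert by auto
  moreover have "1 \<le> b" using insert.prems by simp
  ultimately have "Suc (card S) \<le> b" using card_mono[of "{1..<b}" S] by simp
  then have "r b \<le> r (Suc (card S))" using insert by (intro mono) auto
  moreover have "b \<notin> S" using insert by auto
  ultimately have "(\<Prod>i\<in>insert b S. r i) \<le> r (Suc (card S)) * (\<Prod>i=1..card S. r i)"
    using insert by (simp add: mult_le_mono)
  then show ?case using insert \<open>b \<notin> S\<close> by (simp add: mult.commute)
qed simp

text \<open>Every ordered pair of distinct nodes is joined along at least one list. Summing over the
  lists outermost, each one costs at most \<open>L * R\<close> times the total energy.\<close>

lemma sum_differences_le:
  assumes F: "finite F" and M: "finite M"
    and c: "\<And>m x. m \<in> M \<Longrightarrow> x \<in> F \<Longrightarrow> card (ray F x m) \<le> c m"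
    and reach: "\<And>x y. x \<in> F \<Longrightarrow> y \<in> F \<Longrightarrow> x \<noteq> y \<Longrightarrow> \<exists>\<sigma>\<in>move_orders M L. y \<in> reach F \<sigma> x"
    and R: "\<And>\<sigma>. \<sigma> \<in> move_orders M L \<Longrightarrow> (\<Prod>m\<leftarrow>\<sigma>. c m) \<le> R"
  shows "(\<Sum>x\<in>F. \<Sum>y\<in>F. (\<phi> x - \<phi> y)\<^sup>2)
    \<le> 2 ^ card M * fact L * real L * real R * (\<Sum>m\<in>M. dirichlet_move F \<phi> m)"
proof -
  let ?O = "move_orders M L" and ?E = "\<Sum>m\<in>M. dirichlet_move F \<phi> m"
  have E0: "0 \<le> ?E" by (simp add: sum_nonneg dirichlet_move_nonneg)
  have fO: "finite ?O" by (rule finite_move_orders[OF M])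
  have "(\<Sum>y\<in>F. (\<phi> x - \<phi> y)\<^sup>2) \<le> (\<Sum>\<sigma>\<in>?O. \<Sum>y\<in>reach F \<sigma> x. (\<phi> x - \<phi> y)\<^sup>2)" if x: "x \<in> F" for x
  proof -
    have "(\<Sum>y\<in>F. (\<phi> x - \<phi> y)\<^sup>2) \<le> (\<Sum>y\<in>(\<Union>\<sigma>\<in>?O. reach F \<sigma> x). (\<phi> x - \<phi> y)\<^sup>2)"
    proof -
      have fin: "finite (\<Union>\<sigma>\<in>?O. reach F \<sigma> x)" using fO finite_reach[OF F] by auto
      \<comment> \<open>The diagonal term is 0, so only the nodes other than \<open>x\<close> have
        to be reached.\<close>
      have "(\<Sum>y\<in>F. (\<phi> x - \<phi> y)\<^sup>2) = (\<Sum>y\<in>F - {x}. (\<phi> x - \<phi> y)\<^sup>2)"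
        by (rule sum.mono_neutral_right) (use F in auto)
      also have "\<dots> \<le> (\<Sum>y\<in>(\<Union>\<sigma>\<in>?O. reach F \<sigma> x). (\<phi> x - \<phi> y)\<^sup>2)"
        by (rule sum_mono2[OF fin]) (use reach[OF x] in auto)
      finally show ?thesis .
    qed
    also have "\<dots> \<le> (\<Sum>\<sigma>\<in>?O. \<Sum>y\<in>reach F \<sigma> x. (\<phi> x - \<phi> y)\<^sup>2)"
      by (rule sum_UN_le) (simp_all add: fO finite_reach F)
    finally show ?thesis .
  qed
  then have "(\<Sum>x\<in>F. \<Sum>y\<in>F. (\<phi> x - \<phi> y)\<^sup>2)
      \<le> (\<Sum>x\<in>F. \<Sum>\<sigma>\<in>?O. \<Sum>y\<in>reach F \<sigma> x. (\<phi> x - \<phi> y)\<^sup>2)"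
    by (rule sum_mono)
  also have "\<dots> = (\<Sum>\<sigma>\<in>?O. \<Sum>x\<in>F. \<Sum>y\<in>reach F \<sigma> x. (\<phi> x - \<phi> y)\<^sup>2)"
    by (rule sum.swap)
  also have "\<dots> \<le> (\<Sum>\<sigma>\<in>?O. L * real R * ?E)"
  proof (rule sum_mono)
    fix \<sigma> assume \<sigma>: "\<sigma> \<in> ?O"
    then have sub: "set \<sigma> \<subseteq> M" and dist: "distinct \<sigma>" and len: "length \<sigma> \<le> L"
      by (auto simp: move_orders_def)
    have E: "0 \<le> (\<Sum>m\<leftarrow>\<sigma>. dirichlet_move F \<phi> m)" "(\<Sum>m\<leftarrow>\<sigma>. dirichlet_move F \<phi> m) \<le> ?E"
      unfolding sum_list_distinct_conv_sum_set[OF dist]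
      by (auto intro!: sum_nonneg sum_mono2 dirichlet_move_nonneg M sub)
    have "(\<Sum>x\<in>F. \<Sum>y\<in>reach F \<sigma> x. (\<phi> x - \<phi> y)\<^sup>2)
      \<le> length \<sigma> * real (\<Prod>m\<leftarrow>\<sigma>. c m) * (\<Sum>m\<leftarrow>\<sigma>. dirichlet_move F \<phi> m)"
      by (rule sum_reach_le[OF F]) (use c sub in auto)
    also have "\<dots> \<le> L * real R * ?E"
      by (intro mult_mono) (use len R[OF \<sigma>] E in auto)
    finally show "(\<Sum>x\<in>F. \<Sum>y\<in>reach F \<sigma> x. (\<phi> x - \<phi> y)\<^sup>2) \<le> L * real R * ?E" .
  qed
  also have "\<dots> = card ?O * (L * real R * ?E)" by simp
  also have "\<dots> \<le> (2 ^ card M * fact L) * (L * real R * ?E)"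
  proof (rule mult_right_mono)
    have "real (card ?O) \<le> real (2 ^ card M * fact L)"
      using card_move_orders_le[OF M] by (simp only: of_nat_le_iff)
    then show "real (card ?O) \<le> 2 ^ card M * fact L" by simp
  qed (use E0 in simp)
  finally show ?thesis by (simp add: mult_ac)
qed

text \<open>Augmenting paths use distinct moves, so the \<open>Max\<close> ranges over a finite set
  of lengths at most \<open>card M\<close>; two distinct nodes make this set nonempty and force a
  path with at least one step.\<close>

lemma augmentation_length_bounds:
  assumes F: "finite F" "card F \<ge> 2" and M: "finite M" and aug: "augmenting_markov_basis F M"
  shows "1 \<le> augmentation_length F M" "augmentation_length F M \<le> card M"
    and "\<And>u v. u \<in> F \<Longrightarrow> v \<in> F \<Longrightarrow> u \<noteq> v \<Longrightarrow>
      \<exists>ps. augmenting_path F M u v ps \<and> length ps \<le> augmentation_length F M"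
proof -
  let ?S = "{length ps | u v ps. minimal_augmenting_path F M u v ps}"
  have le: "length ps \<le> card M" if "augmenting_path F M u v ps" for u v ps
  proof -
    have "length ps = card (snd ` set ps)"
      using that by (metis augmenting_path_def distinct_card length_map set_map)
    also have "\<dots> \<le> card M"
      using that by (intro card_mono M) (simp add: augmenting_path_def)
    finally show ?thesis .
  qed
  have sub: "?S \<subseteq> {..card M}" using le by (auto simp: minimal_augmenting_path_def)
  then have fin: "finite ?S" by (rule finite_subset) simp
  have ex: "\<exists>ps. minimal_augmenting_path F M u v ps" if "u \<in> F" "v \<in> F" "u \<noteq> v" for u v
  proof -
    have "\<exists>ps. augmenting_path F M u v ps"
      using aug that by (auto simp: augmenting_markov_basis_def)
    from ex_has_least_nat[of "augmenting_path F M u v" _ length] this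
    show ?thesis unfolding minimal_augmenting_path_def by (meson not_less)
  qed
  show path: "\<exists>ps. augmenting_path F M u v ps \<and> length ps \<le> augmentation_length F M"
    if uv: "u \<in> F" "v \<in> F" "u \<noteq> v" for u v
  proof -
    obtain ps where ps: "minimal_augmenting_path F M u v ps" using ex[OF uv] by blast
    then have "length ps \<le> augmentation_length F M"
      unfolding augmentation_length_def by (intro Max_ge fin) blast
    then show ?thesis using ps by (auto simp: minimal_augmenting_path_def)
  qed
  obtain u v where uv: "u \<in> F" "v \<in> F" "u \<noteq> v"
    using F by (metis card_le_Suc0_iff_eq not_less_eq_eq numeral_2_eq_2)
  obtain ps where ps: "augmenting_path F M u v ps" "length ps \<le> augmentation_length F M"
    using path[OF uv] by blast
  then have "ps \<noteq> []" by (auto simp: augmenting_path_def path_node_def)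
  then show "1 \<le> augmentation_length F M" using ps(2) by (cases ps) auto
  have "?S \<noteq> {}" using ex[OF uv] by blast
  then have "augmentation_length F M \<in> ?S"
    unfolding augmentation_length_def by (rule Max_in[OF fin])
  then show "augmentation_length F M \<le> card M" using sub by auto
qed

section \<open>The bound for the heat-bath walk\<close>

theorem theorem5p8:
  fixes F M :: "(int ^ 'd) set"
    and m :: "nat \<Rightarrow> int ^ 'd"
    and f :: "int ^ 'd \<Rightarrow> real"
    and r :: "nat \<Rightarrow> nat"
    and k L :: nat
  assumes "finite F" and "card F \<ge> 2"
    and "inj_on m {1..k}" and "M = m ` {1..k}"
    and "\<forall>v\<in>M. \<forall>l. l \<notin> {-1, 1} \<longrightarrow> l *s v \<notin> M"
    and "augmenting_markov_basis F M"
    and "positive_mass_function M f"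
    and "\<forall>i\<in>{1..k}. r i = Max {card (ray F u (m i)) | u. u \<in> F}"
    and "\<forall>i\<in>{1..k}. \<forall>j\<in>{1..k}. i \<le> j \<longrightarrow> r i \<ge> r j"
    and "L = augmentation_length F M"
  shows "second_eigenvalue_modulus (matrix_on F (heat_bath F M (uniform_mass F) f))
    \<le> 1 - real (card F) * Min (f ` M) /
          (real L * fact L * 3 ^ (L - 1) * 2 ^ card M * (\<Prod>i=1..L. real (r i)))"
proof -
  note F = assms(1)
  let ?H = "heat_bath F M (uniform_mass F) f"
  define \<mu> where "\<mu> = Min (f ` M)"
  define R where "R = (\<Prod>i=1..L. r i)"
  \<comment> \<open>The constant of \<open>sum_differences_le\<close>, divided by
    \<open>\<mu>\<close> because every move has weight at least \<open>\<mu>\<close> in the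
    walk.\<close>
  define K where "K = 2 ^ card M * fact L * real L * real R / \<mu>"
  have M: "finite M" and cardM: "card M = k" using assms(3,4) by (simp_all add: card_image)
  have L1: "1 \<le> L" and Lk: "L \<le> k"
    using augmentation_length_bounds(1,2)[OF F assms(2) M assms(6)] assms(10) cardM by simp_all
  have fpos: "0 < f v" if "v \<in> M" for v
    using assms(7) that by (simp add: positive_mass_function_def)
  have fsum: "(\<Sum>v\<in>M. f v) = 1"
    using assms(7) by (simp add: positive_mass_function_def mass_function_def)
  have "M \<noteq> {}" using L1 Lk cardM by auto
  then have \<mu>: "0 < \<mu>" and \<mu>_le: "\<And>v. v \<in> M \<Longrightarrow> \<mu> \<le> f v"
    using M fpos by (auto simp: \<mu>_def)
  have r: "card (ray F x (m i)) \<le> r i" if "i \<in> {1..k}" "x \<in> F" for i x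
  proof -
    have "finite {card (ray F u (m i)) | u. u \<in> F}" using F by simp
    then have "card (ray F x (m i)) \<le> Max {card (ray F u (m i)) | u. u \<in> F}"
      by (rule Max_ge) (use that in blast)
    then show ?thesis using assms(8) that by simp
  qed
  obtain x0 where "x0 \<in> F" using assms(2) by fastforce
  then have r1: "1 \<le> r i" if "i \<in> {1..k}" for i
    using r[OF that] card_ray_pos[OF F, of x0 "m i"] by fastforce
  \<comment> \<open>Since \<open>L \<le> k\<close>, every factor is a maximal ray length and hence
    at least 1; outside \<open>{1..k}\<close> the values of \<open>r\<close> are arbitrary.\<close>
  have R1: "1 \<le> R" unfolding R_def
    by (rule prod_ge_1) (use r1 Lk in auto)
  \<comment> \<open>\<open>c\<close> transfers the ray lengths from indices to the moves themselves,
    of which the lists in \<open>move_orders M L\<close> consist.\<close>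
  define c where "c v = r (the_inv_into {1..k} m v)" for v
  have cm: "c (m i) = r i" if "i \<in> {1..k}" for i
    using the_inv_into_f_f[OF assms(3) that] by (simp add: c_def)
  have prod_le: "(\<Prod>v\<leftarrow>\<sigma>. c v) \<le> R" if "\<sigma> \<in> move_orders M L" for \<sigma>
  proof -
    have \<sigma>: "set \<sigma> \<subseteq> M" "distinct \<sigma>" "length \<sigma> \<le> L" using that by (auto simp: move_orders_def)
    obtain S where S: "S \<subseteq> {1..k}" "set \<sigma> = m ` S"
      using \<sigma>(1) assms(4) by (auto simp: subset_image_iff)
    have finS: "finite S" using S by (auto intro: finite_subset)
    have inj: "inj_on m S" using assms(3) S(1) by (rule inj_on_subset)
    have "card S = length \<sigma>" using inj S(2) \<sigma>(2) by (metis card_image distinct_card)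
    then have cS: "card S \<le> L" using \<sigma>(3) by simp
    have "(\<Prod>v\<leftarrow>\<sigma>. c v) = (\<Prod>v\<in>m ` S. c v)"
      using \<sigma>(2) S(2) by (metis prod.distinct_set_conv_list)
    also have "\<dots> = (\<Prod>i\<in>S. r i)"
      unfolding prod.reindex[OF inj] by (rule prod.cong) (use cm S(1) in auto)
    also have "\<dots> \<le> (\<Prod>i=1..card S. r i)"
      by (rule prod_le_prod_initial_segment[OF finS S(1)]) (use assms(9) in auto)
    \<comment> \<open>The product of the first \<open>card S\<close> factors divides the product of
      the first \<open>L\<close>, which is positive.\<close>
    also have "\<dots> \<le> R"
    proof (rule dvd_imp_le)
      show "(\<Prod>i=1..card S. r i) dvd R"
        unfolding R_def by (rule prod_dvd_prod_subset) (use cS in auto)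
      show "0 < R" using R1 by simp
    qed
    finally show ?thesis .
  qed
  have reach: "\<exists>\<sigma>\<in>move_orders M L. y \<in> reach F \<sigma> x" if "x \<in> F" "y \<in> F" "x \<noteq> y" for x y
  proof -
    obtain ps where ps: "augmenting_path F M x y ps" "length ps \<le> L"
      using augmentation_length_bounds(3)[OF F assms(2) M assms(6) \<open>x \<in> F\<close> \<open>y \<in> F\<close> \<open>x \<noteq> y\<close>] assms(10) by blast
    then have "map snd ps \<in> move_orders M L"
      by (simp add: move_orders_def augmenting_path_def)
    then show ?thesis using augmenting_path_mem_reach[OF ps(1)] by blast
  qed
  have sumH: "(\<Sum>y\<in>F. ?H x y * g y)
      = (\<Sum>v\<in>M. f v * (\<Sum>y\<in>F. heat_bath_move F (uniform_mass F) v x y * g y))" for x g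
    unfolding heat_bath_def sum_distrib_left sum_distrib_right
    by (subst sum.swap) (simp add: mult_ac)
  have "poincare_kernel F ?H K"
  proof
    fix x y assume "x \<in> F" "y \<in> F"
    then show "?H x y = ?H y x"
      unfolding heat_bath_def by (simp add: heat_bath_move_uniform_sym[OF F])
  next
    fix x assume x: "x \<in> F"
    have ne: "card (ray F x v) \<noteq> 0" for v
      using card_ray_pos[OF F x, of v] by (simp only: neq0_conv)
    \<comment> \<open>The factor 1 brings the row sum into the form of \<open>sumH\<close>; each ray
      average of 1 is 1.\<close>
    have "(\<Sum>y\<in>F. ?H x y * 1) = (\<Sum>v\<in>M. f v)"
      unfolding sumH sum_heat_bath_move_uniform[OF F x]
      by (rule sum.cong) (simp_all add: ne)
    then show "(\<Sum>y\<in>F. ?H x y) = 1" using fsum by simp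
  next
    fix \<phi> :: "int ^ 'd \<Rightarrow> real"
    have "(\<Sum>x\<in>F. \<phi> x * (\<Sum>y\<in>F. ?H x y * \<phi> y))
      = (\<Sum>v\<in>M. f v * (\<Sum>x\<in>F. \<phi> x * (\<Sum>y\<in>F. heat_bath_move F (uniform_mass F) v x y * \<phi> y)))"
      unfolding sumH sum_distrib_left[of "\<phi> _"] sum_distrib_left[of "f _" _ F]
      by (subst sum.swap) (simp add: mult.left_commute)
    also have "0 \<le> \<dots>"
      by (intro sum_nonneg mult_nonneg_nonneg heat_bath_move_uniform_psd F) (simp add: fpos less_imp_le)
    finally show "0 \<le> (\<Sum>x\<in>F. \<phi> x * (\<Sum>y\<in>F. ?H x y * \<phi> y))" .
  next
    show "0 < K" using \<mu> L1 R1 by (simp add: K_def)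
  next
    fix \<phi> :: "int ^ 'd \<Rightarrow> real"
    let ?D = "\<Sum>x\<in>F. \<Sum>y\<in>F. ?H x y * (\<phi> x - \<phi> y)\<^sup>2"
    have D: "?D = (\<Sum>v\<in>M. f v * dirichlet_move F \<phi> v)"
      unfolding sumH dirichlet_move_def sum_distrib_left[of "f _" _ F] by (rule sum.swap)
    have "\<mu> * (\<Sum>v\<in>M. dirichlet_move F \<phi> v) \<le> ?D"
      unfolding D sum_distrib_left
      by (intro sum_mono mult_right_mono \<mu>_le dirichlet_move_nonneg)
    then have E: "(\<Sum>v\<in>M. dirichlet_move F \<phi> v) \<le> ?D / \<mu>"
      using \<mu> by (simp add: field_simps)
    have "(\<Sum>x\<in>F. \<Sum>y\<in>F. (\<phi> x - \<phi> y)\<^sup>2)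
      \<le> 2 ^ card M * fact L * real L * real R * (\<Sum>v\<in>M. dirichlet_move F \<phi> v)"
      by (rule sum_differences_le[OF F M, where c = c]) (use r cm assms(4) reach prod_le in auto)
    also have "\<dots> \<le> 2 ^ card M * fact L * real L * real R * (?D / \<mu>)"
      by (rule mult_left_mono[OF E]) simp
    finally show "(\<Sum>x\<in>F. \<Sum>y\<in>F. (\<phi> x - \<phi> y)\<^sup>2) \<le> K * ?D" by (simp add: K_def)
  qed (rule F)
  then have "second_eigenvalue_modulus (matrix_on F ?H) \<le> 1 - card F / K"
    using assms(2) by (rule poincare_kernel.second_eigenvalue_modulus_le)
  also have "card F / K = card F * \<mu> / (real L * fact L * 2 ^ card M * real R)"
    by (simp add: K_def mult_ac)
  \<comment> \<open>The factor \<open>3 ^ (L - 1) \<ge> 1\<close> enlarges the denominator and so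
    weakens the bound.\<close>
  also have "1 - card F * \<mu> / (real L * fact L * 2 ^ card M * real R)
    \<le> 1 - card F * \<mu> / (3 ^ (L - 1) * (real L * fact L * 2 ^ card M * real R))"
  proof -
    define B where "B = real L * fact L * 2 ^ card M * real R"
    have B: "0 < B" using L1 R1 by (simp add: B_def)
    have "1 * B \<le> 3 ^ (L - 1) * B" using B by (intro mult_right_mono) auto
    then have "card F * \<mu> / (3 ^ (L - 1) * B) \<le> card F * \<mu> / B"
      using B \<mu> by (intro divide_left_mono) auto
    then show ?thesis by (simp add: B_def)
  qed
  finally show ?thesis by (simp add: \<mu>_def R_def mult_ac)
qed

end
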